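(* Let $m,k\in\mathbb{N}$ with $1\le m<k$, and let $\ell=\lceil k/m\rceil$. Then $\mathtt{Error}_{m/k}\equiv_{LT}\mathtt{Error}_{1/\ell}$.
   Context: A bilayer function is a partial multi-valued function $g\colon\subseteq\mathbb{N}\times\Lambda\rightrightarrows\mathbb{N}$ for some set $\Lambda$; arguments are written $(n\mid c)$ ($n$ public input, $c$ secret input); $\mathrm{dom}_{\rm pub}(g)=\{n:\exists c\,(n\mid c)\in\mathrm{dom}(g)\}$. For $m<k$, $\mathtt{Error}_{m/k}$ is the bilayer function with public input always $\ast$, $\mathrm{dom}(\mathtt{Error}_{m/k})=\{(\ast\mid A):A\subseteq\{0,\dots,k-1\},|A|=m\}$ and $\mathtt{Error}_{m/k}(\ast\mid A)=\{0,\dots,k-1\}\setminus A$. LT-reducibility: for bilayer functions $f,g$, in the game $\mathfrak{G}(f,g)$ Merlin first plays $(x_0\mid c_0)\in\mathrm{dom}(f)$. At round $n$ Arthur plays $\langle j,u_n\rangle$: $j=0$ is a query $u_n\in\mathrm{dom}_{\rm pub}(g)$, $j=1$ declares termination with output $u_n$. After a query Nimue plays $z_n$ with $(u_n\mid z_n)\in\mathrm{dom}(g)$ and Merlin then plays $x_{n+1}\in g(u_n\mid z_n)$. Arthur sees only Merlin's public moves $x_0,x_1,\dots$ and uses a partial computable strategy; Merlin and Nimue see everything and use arbitrary strategies. Arthur and Nimue win if Merlin violates the rules first, or both obey and Arthur terminates with $u_n\in f(x_0\mid c_0)$. $f\le_{LT}g$ iff some Arthur–Nimue strategy wins against all Merlin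 strategies; $\equiv_{LT}$ is the induced equivalence. *)

theory Defs
  imports Complex_Main "HOL-Library.Nat_Bijection"
begin

section \<open>Partial computable functions\<close>

text \<open>
  Kleene's schemes for the partial recursive functions. Arities are not recorded in the syntax:
  an expression denotes one partial function for each length of the argument list, and a scheme
  that does not fit that length (such as a projection out of range) has no value there.
  The relation \<^term>\<open>rec_eval r xs y\<close> below says that \<^term>\<open>r\<close> halts on \<^term>\<open>xs\<close> with value \<^term>\<open>y\<close>.
\<close>

datatype recf =
    Zero
  | Succ
  | Proj nat
  | Comp recf "recf list"
  | PrimRec recf recf
  | Mu recf

inductive rec_eval :: "recf \<Rightarrow> nat list \<Rightarrow> nat \<Rightarrow> bool" where
  rec_eval_Zero: "rec_eval Zero xs 0"
| rec_eval_Succ: "rec_eval Succ [x] (Suc x)"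
| rec_eval_Proj: "i < length xs \<Longrightarrow> rec_eval (Proj i) xs (xs ! i)"
| rec_eval_Comp:
    "list_all2 (\<lambda>g y. rec_eval g xs y) gs ys \<Longrightarrow> rec_eval f ys z
      \<Longrightarrow> rec_eval (Comp f gs) xs z"
| rec_eval_PrimRec_0: "rec_eval f xs y \<Longrightarrow> rec_eval (PrimRec f g) (0 # xs) y"
| rec_eval_PrimRec_Suc:
    "rec_eval (PrimRec f g) (n # xs) r \<Longrightarrow> rec_eval g (r # n # xs) y
      \<Longrightarrow> rec_eval (PrimRec f g) (Suc n # xs) y"
| rec_eval_Mu:
    "rec_eval f (n # xs) 0 \<Longrightarrow> (\<forall>i<n. \<exists>y. rec_eval f (i # xs) (Suc y))
      \<Longrightarrow> rec_eval (Mu f) xs n"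

definition partial_computable :: "(nat list \<rightharpoonup> nat) \<Rightarrow> bool" where
  "partial_computable \<sigma> \<longleftrightarrow>
    (\<exists>r. \<forall>xs y. \<sigma> xs = Some y \<longleftrightarrow> rec_eval r [list_encode xs] y)"


section \<open>Bilayer functions\<close>

text \<open>
  A partial multi-valued function is a partial map into sets of values. The pair
  \<^term>\<open>(n, c)\<close> stands for the argument \<open>(n | c)\<close> with public part \<^term>\<open>n\<close> and secret part \<^term>\<open>c\<close>.
\<close>

type_synonym 'c bilayer = "nat \<times> 'c \<rightharpoonup> nat set"

definition dom_pub :: "'c bilayer \<Rightarrow> nat set" where
  "dom_pub g = {n. \<exists>c. (n, c) \<in> dom g}"

text \<open>The dummy public input \<open>\<ast>\<close> is coded by \<^term>\<open>0::nat\<close>.\<close>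

definition Error :: "nat \<Rightarrow> nat \<Rightarrow> nat set bilayer" where
  "Error m k = (\<lambda>(n, A).
     if n = 0 \<and> A \<subseteq> {..<k} \<and> card A = m then Some ({..<k} - A) else None)"


section \<open>LT-reducibility\<close>

text \<open>
  After Merlin's opening \<^term>\<open>(x\<^sub>0, c\<^sub>0)\<close>, a play consists of rounds \<open>(u\<^sub>n, z\<^sub>n, x\<^sub>n\<^sub>+\<^sub>1)\<close>, the moves of
  Arthur, Nimue and Merlin. A history is the list of the completed rounds, oldest first.
  Arthur's move \<open>\<langle>j, u\<rangle>\<close> is the number \<^term>\<open>prod_encode (j, u)\<close>.
\<close>

type_synonym 'd history = "(nat \<times> 'd \<times> nat) list"

type_synonym arthur_strategy = "nat list \<rightharpoonup> nat"

type_synonym ('c, 'd) nimue_strategy = "nat \<times> 'c \<Rightarrow> 'd history \<Rightarrow> nat \<Rightarrow> 'd"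

type_synonym ('c, 'd) merlin_strategy = "(nat \<times> 'c) \<times> ('d history \<Rightarrow> nat \<Rightarrow> 'd \<Rightarrow> nat)"

definition public_moves :: "nat \<times> 'c \<Rightarrow> 'd history \<Rightarrow> nat list" where
  "public_moves p h = fst p # map (\<lambda>(u, z, x). x) h"

text \<open>
  Arthur and Nimue win the continuation of a play that has been legal so far, with opening
  \<^term>\<open>p\<close> and history \<^term>\<open>h\<close>. As the predicate is a least fixed point, they lose infinite plays;
  they also lose when Arthur's strategy is undefined or when one of them breaks the rules.
\<close>

inductive wins_from ::
  "'c bilayer \<Rightarrow> 'd bilayer \<Rightarrow> arthur_strategy \<Rightarrow> ('c, 'd) nimue_strategy \<Rightarrow>
    nat \<times> 'c \<Rightarrow> ('d history \<Rightarrow> nat \<Rightarrow> 'd \<Rightarrow> nat) \<Rightarrow> 'd history \<Rightarrow> bool"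
  for f :: "'c bilayer" and g :: "'d bilayer" and \<sigma> \<nu> p \<mu>
where
  arthur_terminates:
    "\<sigma> (public_moves p h) = Some (prod_encode (1, u)) \<Longrightarrow> u \<in> the (f p)
      \<Longrightarrow> wins_from f g \<sigma> \<nu> p \<mu> h"
| merlin_violates:
    "\<sigma> (public_moves p h) = Some (prod_encode (0, u)) \<Longrightarrow> u \<in> dom_pub g
      \<Longrightarrow> z = \<nu> p h u \<Longrightarrow> (u, z) \<in> dom g
      \<Longrightarrow> \<mu> h u z \<notin> the (g (u, z))
      \<Longrightarrow> wins_from f g \<sigma> \<nu> p \<mu> h"
| next_round:
    "\<sigma> (public_moves p h) = Some (prod_encode (0, u)) \<Longrightarrow> u \<in> dom_pub g
      \<Longrightarrow> z = \<nu> p h u \<Longrightarrow> (u, z) \<in> dom g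
      \<Longrightarrow> x = \<mu> h u z \<Longrightarrow> x \<in> the (g (u, z))
      \<Longrightarrow> wins_from f g \<sigma> \<nu> p \<mu> (h @ [(u, z, x)])
      \<Longrightarrow> wins_from f g \<sigma> \<nu> p \<mu> h"

definition wins ::
  "'c bilayer \<Rightarrow> 'd bilayer \<Rightarrow> arthur_strategy \<Rightarrow> ('c, 'd) nimue_strategy \<Rightarrow>
    ('c, 'd) merlin_strategy \<Rightarrow> bool" where
  "wins f g \<sigma> \<nu> M \<longleftrightarrow> fst M \<notin> dom f \<or> wins_from f g \<sigma> \<nu> (fst M) (snd M) []"

definition LT_reducible :: "'c bilayer \<Rightarrow> 'd bilayer \<Rightarrow> bool" (infix \<open>\<le>\<^sub>L\<^sub>T\<close> 50) where
  "f \<le>\<^sub>L\<^sub>T g \<longleftrightarrow> (\<exists>\<sigma> \<nu>. partial_computable \<sigma> \<and> (\<forall>M. wins f g \<sigma> \<nu> M))"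

definition LT_equivalent :: "'c bilayer \<Rightarrow> 'd bilayer \<Rightarrow> bool" (infix \<open>\<equiv>\<^sub>L\<^sub>T\<close> 50) where
  "f \<equiv>\<^sub>L\<^sub>T g \<longleftrightarrow> f \<le>\<^sub>L\<^sub>T g \<and> g \<le>\<^sub>L\<^sub>T f"

end

theory Submission
  imports Defs
begin

text \<open>
  Cutting \<open>{0, \<dots>, k-1}\<close> into \<open>\<ell>\<close> blocks of size at most \<open>m\<close>, Nimue hides the block
  of the one wrong answer inside her \<open>m\<close>-set; this reduces \<open>Error 1/\<ell>\<close> to \<open>Error m/k\<close> with one query.
  Conversely, Arthur keeps a list of candidates for the secret \<open>m\<close>-set. As long as at least \<open>\<ell>\<close> are
  left, he queries \<open>Error 1/\<ell>\<close> about the first \<open>\<ell>\<close>, Nimue forbids the index of the true one, and the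
  candidate named by Merlin is discarded. At most \<open>\<ell>-1\<close> candidates remain in the end; their
  union has at most \<open>(\<ell>-1)m < k\<close> elements, so some value avoids them all. Both strategies of Arthur
  are finite, hence computable.
\<close>

section \<open>Finite partial functions are computable\<close>

text \<open>Needed to read a halting search backwards: a program known to compute a table can return
  no other entry.\<close>

lemma rec_eval_deterministic:
  "rec_eval r xs y \<Longrightarrow> rec_eval r xs y' \<Longrightarrow> y = y'"
proof (induction arbitrary: y' rule: rec_eval.induct)
  case (rec_eval_Comp xs gs ys f z)
  from rec_eval_Comp.prems obtain ys' where
    ys': "list_all2 (\<lambda>g y. rec_eval g xs y) gs ys'" and z: "rec_eval f ys' y'"
    by cases auto
  have "ys = ys'"
    using rec_eval_Comp.IH(1) ys'
    by (auto simp: list_all2_conv_all_nth intro!: nth_equalityI)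
  then show ?case using rec_eval_Comp.IH(2) z by simp
next
  case (rec_eval_PrimRec_Suc f g n xs r y)
  from rec_eval_PrimRec_Suc.prems obtain r' where
    "rec_eval (PrimRec f g) (n # xs) r'" "rec_eval g (r' # n # xs) y'"
    by cases auto
  then show ?case using rec_eval_PrimRec_Suc.IH by blast
next
  case (rec_eval_Mu f n xs)
  from rec_eval_Mu.prems obtain
    zero: "rec_eval f (y' # xs) 0" and pos: "\<forall>i<y'. \<exists>y. rec_eval f (i # xs) (Suc y)"
    by cases auto
  \<comment> \<open>If \<open>n\<close> and \<open>y'\<close> differed, then at the smaller one
    \<open>f\<close> would return zero in one derivation and a successor in the other.\<close>
  have "\<not> n < y'" using pos rec_eval_Mu.IH(1) by blast
  moreover have "\<not> y' < n" using zero rec_eval_Mu.IH(2) by blast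
  ultimately show ?case by simp
next
  case (rec_eval_PrimRec_0 f xs y g)
  from rec_eval_PrimRec_0.prems have "rec_eval f xs y'" by cases auto
  then show ?case using rec_eval_PrimRec_0.IH by blast
next
  case (rec_eval_Zero xs)
  then show ?case by cases auto
next
  case (rec_eval_Succ x)
  then show ?case by cases auto
next
  case (rec_eval_Proj i xs)
  from rec_eval_Proj.prems show ?case by cases auto
qed

lemma ex_rec_const: "\<exists>r. \<forall>xs. rec_eval r xs c"
proof (induction c)
  case 0
  show ?case using rec_eval_Zero by blast
next
  case (Suc c)
  then obtain r where "\<forall>xs. rec_eval r xs c" by blast
  then have "\<forall>xs. rec_eval (Comp Succ [r]) xs (Suc c)"
    by (auto intro!: rec_eval_Comp[where ys = "[c]"] rec_eval_Succ)
  then show ?case by blast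
qed

text \<open>Induction on the threshold: primitive recursion acts as a case split, the base giving
  \<open>h 0\<close> and the step a program for the shifted table. \<open>Proj 1\<close> fetches the
  predecessor, so the recursive value is ignored.\<close>

lemma ex_rec_eventually_const:
  assumes "\<And>n. N \<le> n \<Longrightarrow> h n = c"
  shows "\<exists>r. \<forall>n. rec_eval r [n] (h n)"
  using assms
proof (induction N arbitrary: h)
  case 0
  then show ?case using ex_rec_const[of c] by auto
next
  case (Suc N)
  obtain r where r: "\<forall>n. rec_eval r [n] (h (Suc n))"
    using Suc.IH[of "\<lambda>n. h (Suc n)"] Suc.prems by auto
  obtain b where b: "\<forall>xs. rec_eval b xs (h 0)" using ex_rec_const by blast
  have "rec_eval (PrimRec b (Comp r [Proj 1])) [n] (h n)" for n
  proof (induction n)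
    case 0
    show ?case using b by (auto intro: rec_eval_PrimRec_0)
  next
    case (Suc n)
    show ?case
      by (rule rec_eval_PrimRec_Suc[OF Suc], rule rec_eval_Comp[where ys = "[n]"])
        (use r rec_eval_Proj[of 1 "[h n, n]"] in auto)
  qed
  then show ?case by blast
qed

text \<open>The same induction, now peeling off rows: row 0 is a one-argument table, and the
  remaining rows form a smaller instance.\<close>

lemma ex_rec_eventually_const2:
  assumes "\<And>i n. M \<le> i \<Longrightarrow> h i n = c" and "\<And>i n. N \<le> n \<Longrightarrow> h i n = c"
  shows "\<exists>r. \<forall>i n. rec_eval r [i, n] (h i n)"
  using assms
proof (induction M arbitrary: h)
  case 0
  then show ?case using ex_rec_const[of c] by auto
next
  case (Suc M)
  obtain r where r: "\<forall>i n. rec_eval r [i, n] (h (Suc i) n)"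
    using Suc.IH[of "\<lambda>i. h (Suc i)"] Suc.prems by auto
  obtain b where b: "\<forall>n. rec_eval b [n] (h 0 n)"
    using ex_rec_eventually_const[of N "h 0" c] Suc.prems by auto
  have "rec_eval (PrimRec b (Comp r [Proj 1, Proj 2])) [i, n] (h i n)" for i n
  proof (induction i)
    case 0
    show ?case using b by (auto intro: rec_eval_PrimRec_0)
  next
    case (Suc i)
    show ?case
      by (rule rec_eval_PrimRec_Suc[OF Suc], rule rec_eval_Comp[where ys = "[i, n]"])
        (use r rec_eval_Proj[of 1 "[h i n, i, n]"] rec_eval_Proj[of 2 "[h i n, i, n]"] in auto)
  qed
  then show ?case by blast
qed

text \<open>The graph of \<open>\<sigma>\<close> is searched for the output. Finiteness makes its
  characteristic table constant outside a finite box, and where \<open>\<sigma>\<close> is undefined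
  the search never halts.\<close>

lemma partial_computable_finite_dom:
  assumes "finite (dom \<sigma>)"
  shows "partial_computable \<sigma>"
proof -
  \<comment> \<open>Zero marks a hit, as \<open>Mu\<close> looks for a zero; the candidate output
    \<open>i\<close> comes first because \<open>Mu\<close> puts its search variable at the
    head.\<close>
  define h where "h i n = (if \<sigma> (list_decode n) = Some i then 0 else 1 :: nat)" for i n
  obtain M where M: "\<forall>i \<in> ran \<sigma>. i < M"
    using finite_ran[OF assms] finite_nat_set_iff_bounded by blast
  obtain N where N: "\<forall>n \<in> list_encode ` dom \<sigma>. n < N"
    using assms finite_nat_set_iff_bounded by blast
  have "h i n = 1" if "M \<le> i" for i n
    using M that by (force simp: h_def ran_def)
  moreover have "h i n = 1" if "N \<le> n" for i n
    using N that by (force simp: h_def dom_def image_iff)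
  ultimately obtain r where r: "\<And>i n. rec_eval r [i, n] (h i n)"
    using ex_rec_eventually_const2[of M h 1 N] by blast
  have "\<sigma> xs = Some y \<longleftrightarrow> rec_eval (Mu r) [list_encode xs] y" for xs y
  proof
    assume y: "\<sigma> xs = Some y"
    show "rec_eval (Mu r) [list_encode xs] y"
    proof (rule rec_eval_Mu)
      show "rec_eval r [y, list_encode xs] 0"
        using r[of y "list_encode xs"] y by (simp add: h_def)
      show "\<forall>i<y. \<exists>z. rec_eval r [i, list_encode xs] (Suc z)"
      proof (intro allI impI exI)
        fix i assume "i < y"
        then show "rec_eval r [i, list_encode xs] (Suc 0)"
          using r[of i "list_encode xs"] y by (simp add: h_def)
      qed
    qed
  next
    assume "rec_eval (Mu r) [list_encode xs] y"
    then have "rec_eval r [y, list_encode xs] 0" by cases auto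
    then have "h y (list_encode xs) = 0" using r rec_eval_deterministic by blast
    then show "\<sigma> xs = Some y" by (simp add: h_def split: if_splits)
  qed
  then show ?thesis unfolding partial_computable_def by blast
qed


section \<open>The reductions\<close>

lemma dom_Error: "dom (Error m k) = {(n, A). n = 0 \<and> A \<subseteq> {..<k} \<and> card A = m}"
  by (auto simp: Error_def dom_def split: if_splits)

lemma the_Error: "A \<subseteq> {..<k} \<Longrightarrow> card A = m \<Longrightarrow> the (Error m k (0, A)) = {..<k} - A"
  by (simp add: Error_def)

lemma dom_pub_Error:
  assumes "m \<le> k"
  shows "dom_pub (Error m k) = {0}"
proof -
  have "{..<m} \<subseteq> {..<k}" "card {..<m} = m" using assms by auto
  then have "\<exists>A\<subseteq>{..<k}. card A = m" by blast
  then show ?thesis by (auto simp: dom_pub_def dom_Error)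
qed

lemma Error_1_LT_reducible:
  assumes "0 < m" and "m \<le> k" and "k \<le> l * m"
  shows "Error 1 l \<le>\<^sub>L\<^sub>T Error m k"
proof -
  \<comment> \<open>Block \<open>a\<close> consists of the numbers with quotient \<open>a\<close>.
    It can be shorter than \<open>m\<close>, so it is padded to the exact size that the domain of
    \<open>Error m k\<close> demands.\<close>
  have hide: "\<exists>B. {x. x < k \<and> x div m = a} \<subseteq> B \<and> B \<subseteq> {..<k} \<and> card B = m" for a
  proof -
    have "{x. x < k \<and> x div m = a} \<subseteq> {a * m ..< a * m + m}"
    proof
      fix x assume "x \<in> {x. x < k \<and> x div m = a}"
      then show "x \<in> {a * m ..< a * m + m}"
        using div_mult_mod_eq[of x m] mod_less_divisor[OF \<open>0 < m\<close>, of x] by auto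
    qed
    then have "card {x. x < k \<and> x div m = a} \<le> m"
      using card_mono[OF finite_atLeastLessThan, of _ "a * m" "a * m + m"] by simp
    then show ?thesis
      using exists_subset_between[of "{x. x < k \<and> x div m = a}" m "{..<k}"] assms(2) by auto
  qed
  define block where
    "block a = (SOME B. {x. x < k \<and> x div m = a} \<subseteq> B \<and> B \<subseteq> {..<k} \<and> card B = m)" for a
  have block: "{x. x < k \<and> x div m = a} \<subseteq> block a" "block a \<subseteq> {..<k}" "card (block a) = m" for a
    using someI_ex[OF hide[of a]] unfolding block_def by auto
  \<comment> \<open>Query first, then output the block of the answer. Listing only answers below
    \<open>k\<close> keeps the domain finite.\<close>
  define \<sigma> where
    "\<sigma> xs = (if xs = [0] then Some (prod_encode (0, 0))
             else if xs \<in> (\<lambda>x. [0, x]) ` {..<k} then Some (prod_encode (1, xs ! 1 div m))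
             else None)" for xs
  define \<nu> :: "(nat set, nat set) nimue_strategy" where
    "\<nu> p h u = block (the_elem (snd p))" for p h u
  have "dom \<sigma> \<subseteq> insert [0] ((\<lambda>x. [0, x]) ` {..<k})"
    by (auto simp: \<sigma>_def split: if_splits)
  then have "partial_computable \<sigma>"
    by (intro partial_computable_finite_dom) (erule finite_subset, simp)
  moreover have "wins (Error 1 l) (Error m k) \<sigma> \<nu> M" for M
  proof (cases "fst M \<in> dom (Error 1 l)")
    case True
    then obtain a where a: "fst M = (0, {a})" "a < l"
      by (auto simp: dom_Error card_1_singleton_iff)
    define x where "x = snd M [] 0 (block a)"
    have \<sigma>0: "\<sigma> (public_moves (fst M) []) = Some (prod_encode (0, 0))"
      by (simp add: \<sigma>_def a public_moves_def)
    have \<nu>0: "\<nu> (fst M) h u = block a" for h u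
      by (simp add: \<nu>_def a)
    have in_dom: "(0, block a) \<in> dom (Error m k)" using block by (simp add: dom_Error)
    have answers: "the (Error m k (0, block a)) = {..<k} - block a"
      using block by (simp add: the_Error)
    have "wins_from (Error 1 l) (Error m k) \<sigma> \<nu> (fst M) (snd M) []"
    proof (cases "x \<in> {..<k} - block a")
      case False
      then show ?thesis
        using \<sigma>0 in_dom answers dom_pub_Error[OF assms(2)] \<nu>0
        by (intro merlin_violates[where u = 0 and z = "block a"]) (simp_all add: x_def)
    next
      case x: True
      have "x div m < l" using x assms by (simp add: div_less_iff_less_mult)
      moreover have "x div m \<noteq> a" using x block(1)[of a] by auto
      ultimately have "x div m \<in> the (Error 1 l (fst M))"
        using a by (simp add: the_Error)
      moreover have "\<sigma> (public_moves (fst M) [(0, block a, x)]) = Some (prod_encode (1, x div m))"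
        using x by (auto simp: \<sigma>_def a public_moves_def)
      ultimately have "wins_from (Error 1 l) (Error m k) \<sigma> \<nu> (fst M) (snd M) ([] @ [(0, block a, x)])"
        by (intro arthur_terminates) auto
      then show ?thesis
        by - (rule next_round[where u = 0 and z = "block a" and x = x],
          use x \<sigma>0 in_dom answers dom_pub_Error[OF assms(2)] \<nu>0 in \<open>simp_all add: x_def\<close>)
    qed
    then show ?thesis by (simp add: wins_def)
  qed (simp add: wins_def)
  ultimately show ?thesis unfolding LT_reducible_def by blast
qed

section \<open>Candidate lists and the converse reduction\<close>

definition remove_nth :: "nat \<Rightarrow> 'a list \<Rightarrow> 'a list" where
  "remove_nth j C = take j C @ drop (Suc j) C"

lemma length_remove_nth: "j < length C \<Longrightarrow> length (remove_nth j C) = length C - 1"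
  by (simp add: remove_nth_def)

lemma set_remove_nth_subset: "set (remove_nth j C) \<subseteq> set C"
  by (auto simp: remove_nth_def dest: in_set_takeD in_set_dropD)

text \<open>Keeps the true candidate alive: entries before \<open>j\<close> lie in the
  \<open>take\<close> part, later ones in the \<open>drop\<close> part, shifted by
  \<open>Suc j\<close>.\<close>

lemma nth_in_set_remove_nth:
  assumes "i < length C" and "j < length C" and "i \<noteq> j"
  shows "C ! i \<in> set (remove_nth j C)"
proof (cases "i < j")
  case True
  then have "C ! i \<in> set (take j C)" using assms by (auto simp: in_set_conv_nth)
  then show ?thesis by (simp add: remove_nth_def)
next
  case False
  then have "drop (Suc j) C ! (i - Suc j) = C ! i" "i - Suc j < length (drop (Suc j) C)"
    using assms by auto
  then have "C ! i \<in> set (drop (Suc j) C)" by (metis nth_mem)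
  then show ?thesis by (simp add: remove_nth_def)
qed

text \<open>Union bound: at most \<open>b\<close> sets of size \<open>m\<close> cannot cover
  \<open>k\<close> points. Repetitions in \<open>C\<close> only lower the count.\<close>

lemma ex_avoiding:
  assumes "\<forall>A \<in> set C. A \<subseteq> {..<k} \<and> card A = m" and "length C \<le> b" and "b * m < k"
  shows "\<exists>u<k. u \<notin> \<Union> (set C)"
proof (rule ccontr)
  assume "\<not> ?thesis"
  then have "{..<k} \<subseteq> \<Union> (set C)" by auto
  moreover have "finite (\<Union> (set C))" using assms(1) by (auto intro: finite_subset)
  ultimately have "k \<le> card (\<Union> (set C))" using card_mono[of "\<Union> (set C)" "{..<k}"] by simp
  also have "\<dots> \<le> (\<Sum>A \<in> set C. card A)"
    by (rule card_Union_le_sum_card)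
  also have "\<dots> = card (set C) * m" using assms(1) by simp
  also have "\<dots> \<le> b * m" using card_length[of C] assms(2) by (intro mult_right_mono) auto
  finally show False using assms(3) by simp
qed

lemma Error_LT_reducible_1:
  assumes "0 < l" and "(l - 1) * m < k"
  shows "Error m k \<le>\<^sub>L\<^sub>T Error 1 l"
proof -
  have fin: "finite {A. A \<subseteq> {..<k} \<and> card A = m}" by simp
  obtain L where L: "set L = {A. A \<subseteq> {..<k} \<and> card A = m}"
    using finite_list[OF fin] by metis
  \<comment> \<open>The survivors after the answers \<open>js\<close>. They depend on public moves
    only, so Arthur can replay them.\<close>
  define rem where "rem js = fold remove_nth js L" for js
  define guess where "guess C = (SOME u. u < k \<and> u \<notin> \<Union> (set C))" for C
  \<comment> \<open>Each legal answer discards one candidate, so \<open>length L\<close> bounds the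
    rounds and Arthur's table is finite.\<close>
  define J where "J = {js. set js \<subseteq> {..<l} \<and> length js \<le> length L}"
  define \<sigma> where
    "\<sigma> xs = (if xs \<in> (#) 0 ` J
             then Some (if length (rem (tl xs)) < l then prod_encode (1, guess (rem (tl xs)))
                        else prod_encode (0, 0))
             else None)" for xs
  define answers :: "nat set history \<Rightarrow> nat list" where "answers = map (\<lambda>(u, z, x). x)"
  \<comment> \<open>If \<open>A\<close> is not among the first \<open>l\<close> candidates, no legal
    answer can discard it, so the default 0 is harmless; it is a legal index since
    \<open>0 < l\<close>.\<close>
  define index where
    "index A C = (if \<exists>i<l. C ! i = A then SOME i. i < l \<and> C ! i = A else 0)" for A and C :: "nat set list"
  define \<nu> :: "(nat set, nat set) nimue_strategy" where
    "\<nu> p h u = {index (snd p) (rem (answers h))}" for p h u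
  have "finite J" unfolding J_def by (rule finite_lists_length_le) simp
  moreover have "dom \<sigma> \<subseteq> (#) 0 ` J" by (auto simp: \<sigma>_def split: if_splits)
  ultimately have "partial_computable \<sigma>"
    by (metis partial_computable_finite_dom finite_subset finite_imageI)
  moreover have "wins (Error m k) (Error 1 l) \<sigma> \<nu> M" for M
  proof (cases "fst M \<in> dom (Error m k)")
    case True
    then obtain A where A: "fst M = (0, A)" "A \<subseteq> {..<k}" "card A = m"
      by (auto simp: dom_Error)
    \<comment> \<open>Invariant for induction on the number of survivors: the length equation keeps
      the answers in \<open>J\<close>, and survival of \<open>A\<close> rules out the empty
      list.\<close>
    have "wins_from (Error m k) (Error 1 l) \<sigma> \<nu> (fst M) (snd M) h"
      if "set (answers h) \<subseteq> {..<l}" "length (answers h) + length (rem (answers h)) = length L"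
        "A \<in> set (rem (answers h))" "set (rem (answers h)) \<subseteq> set L" for h
      using that
    proof (induction "length (rem (answers h))" arbitrary: h)
      case 0
      then show ?case by simp
    next
      case (Suc n)
      define C where "C = rem (answers h)"
      have moves: "public_moves (fst M) h = 0 # answers h"
        by (simp add: public_moves_def answers_def A)
      have J: "answers h \<in> J" using Suc.prems by (simp add: J_def)
      show ?case
      proof (cases "length C < l")
        case True
        have "\<exists>u. u < k \<and> u \<notin> \<Union> (set C)"
        proof (rule ex_avoiding)
          show "\<forall>A \<in> set C. A \<subseteq> {..<k} \<and> card A = m" using Suc.prems(4) L by (auto simp: C_def)
          show "length C \<le> l - 1" using True by simp
        qed (rule assms(2))
        then have "guess C < k \<and> guess C \<notin> \<Union> (set C)"
          unfolding guess_def by (rule someI_ex)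
        then have "guess C \<in> the (Error m k (fst M))"
          using A Suc.prems(3) by (auto simp: the_Error C_def)
        moreover have "\<sigma> (public_moves (fst M) h) = Some (prod_encode (1, guess C))"
          using J True by (simp add: \<sigma>_def moves C_def)
        ultimately show ?thesis by (intro arthur_terminates) auto
      next
        case False
        then have \<sigma>h: "\<sigma> (public_moves (fst M) h) = Some (prod_encode (0, 0))"
          using J by (simp add: \<sigma>_def moves C_def)
        define i where "i = index A C"
        have i: "i < l \<and> ((\<exists>i<l. C ! i = A) \<longrightarrow> C ! i = A)"
          using someI_ex[of "\<lambda>i. i < l \<and> C ! i = A"] assms(1)
          by (auto simp: i_def index_def)
        have \<nu>h: "{i} = \<nu> (fst M) h 0" by (simp add: \<nu>_def A i_def C_def)
        have pub: "0 \<in> dom_pub (Error 1 l)" using dom_pub_Error[of 1 l] assms(1) by simp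
        have in_dom: "(0, {i}) \<in> dom (Error 1 l)" using i by (simp add: dom_Error)
        have legal: "the (Error 1 l (0, {i})) = {..<l} - {i}" using i by (simp add: the_Error)
        define x where "x = snd M h 0 {i}"
        show ?thesis
        proof (cases "x \<in> {..<l} - {i}")
          case False
          then show ?thesis
            using \<sigma>h pub \<nu>h in_dom legal
            by (intro merlin_violates[where u = 0 and z = "{i}"]) (simp_all add: x_def)
        next
          case x: True
          define h' where "h' = h @ [(0::nat, {i}, x)]"
          have answers': "answers h' = answers h @ [x]" by (simp add: answers_def h'_def)
          have rem': "rem (answers h @ [x]) = remove_nth x C"
            by (simp add: rem_def C_def)
          \<comment> \<open>A legal answer satisfies \<open>x < l \<le> length C\<close>, so exactly
            one candidate disappears.\<close>
          have "x < length C" using x False by simp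
          then have len: "length (remove_nth x C) = n" "Suc n = length C"
            using Suc.hyps(2) by (simp_all add: length_remove_nth C_def)
          obtain j where j: "j < length C" "C ! j = A"
            using Suc.prems(3) by (auto simp: C_def in_set_conv_nth)
          have "A \<in> set (remove_nth x C)"
          \<comment> \<open>Either Nimue protected an occurrence of \<open>A\<close> at
            \<open>i \<noteq> x\<close>, or every occurrence lies at position at least
            \<open>l\<close>, beyond \<open>x\<close>.\<close>
          proof (cases "\<exists>i<l. C ! i = A")
            case True
            then show ?thesis
              using nth_in_set_remove_nth[of i C x] i x False by auto
          next
            case no: False
            then have "j \<noteq> x" using j x by auto
            then show ?thesis using nth_in_set_remove_nth[of j C x] j \<open>x < length C\<close> by auto
          qed
          then have "wins_from (Error m k) (Error 1 l) \<sigma> \<nu> (fst M) (snd M) h'"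
            using Suc.prems x len set_remove_nth_subset[of x C]
            by (intro Suc.hyps(1)) (auto simp: rem' answers' C_def)
          then show ?thesis
            by - (rule next_round[where u = 0 and z = "{i}" and x = x],
              use x \<sigma>h pub \<nu>h in_dom legal in \<open>simp_all add: x_def h'_def\<close>)
        qed
      qed
    qed
    from this[of "[]"] show ?thesis
      using A L by (simp add: wins_def answers_def rem_def)
  qed (simp add: wins_def)
  ultimately show ?thesis unfolding LT_reducible_def by blast
qed

theorem mainTheorem2:
  fixes m k l :: nat
  assumes "1 \<le> m" and "m < k" and "l = nat \<lceil>real k / real m\<rceil>"
  shows "Error m k \<equiv>\<^sub>L\<^sub>T Error 1 l"
proof -
  have m: "real m > 0" using assms(1) by simp
  have "0 < real k / real m" using assms by simp
  then have l: "0 < l" and l_int: "int l = \<lceil>real k / real m\<rceil>" using assms(3) by auto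
  \<comment> \<open>Multiplied by \<open>m\<close>, the two ceiling bounds become the hypotheses of
    the two reductions; \<open>0 < l\<close> makes the natural-number \<open>l - 1\<close> agree
    with the real one.\<close>
  have "real k / real m \<le> real l" "real l - 1 < real k / real m"
    using l_int by linarith+
  then have "real k \<le> real l * real m" "(real l - 1) * real m < real k"
    using m by (simp_all add: field_simps)
  then have "real k \<le> real (l * m)" "real ((l - 1) * m) < real k"
    using l by (simp_all add: of_nat_diff)
  then have "k \<le> l * m" "(l - 1) * m < k" by (simp_all only: of_nat_le_iff of_nat_less_iff)
  then show ?thesis
    unfolding LT_equivalent_def
    using Error_LT_reducible_1[OF l] Error_1_LT_reducible assms(1,2) by simp
qed

end
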